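(* Let $d\ge 2$ and let $\Lambda\subseteq\tilde{\mathcal K}^d$ be a lattice. Then every orthogonal $\mathcal R$-basis of $\Lambda$ is a basis of successive minima of $\Lambda$; that is, if $\{\mathbf v_1,\dots,\mathbf v_d\}$ is an $\mathcal R$-basis of $\Lambda$ which is orthogonal, ordered so that $\|\mathbf v_1\|\le\dots\le\|\mathbf v_d\|$, then $\|\mathbf v_i\|=\lambda_i(\Lambda)$ for every $i=1,\dots,d$.
   Context: Let $q$ be a prime power, $\mathcal R=\mathbb F_q[x]$, and $\tilde{\mathcal K}=\mathbb F_q((x^{-1}))$, with the absolute value $|\cdot|$ extending $|f|=q^{\deg f}$ for nonzero $f\in\mathcal R$ (and $|0|=0$). On $\tilde{\mathcal K}^d$ use the norm $\|\mathbf v\|=\max_i|v_i|$. A lattice in $\tilde{\mathcal K}^d$ is a set $\Lambda=g\mathcal R^d$ with $g\in\mathrm{GL}_d(\tilde{\mathcal K})$. For $i=1,\dots,d$, $\lambda_i(\Lambda)=\min\{r>0:\text{ there exist } i \text{ linearly independent vectors in }\Lambda\text{ of norm}\le r\}$. Linearly independent vectors $\mathbf v^{(1)},\dots,\mathbf v^{(d)}\in\Lambda$ form a basis of successive minima for $\Lambda$ if $\|\mathbf v^{(i)}\|=\lambda_i(\Lambda)$ for each $i$. Vectors $\mathbf v_1,\dots,\mathbf v_d\in\tilde{\mathcal K}^d$ are orthogonal if $\|\mathbf v_1\wedge\dots\wedge\mathbf v_d\|=\prod_{i=1}^d\|\mathbf v_i\|$ (the left side being the absolute value of the determinant of the matrix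 with columns $\mathbf v_i$); for nonzero vectors this is equivalent to $\|\alpha_1\mathbf v_1+\dots+\alpha_d\mathbf v_d\|=\max_i\|\alpha_i\mathbf v_i\|$ for all $\alpha_1,\dots,\alpha_d\in\tilde{\mathcal K}$. *)

theory Defs
  imports "HOL-Analysis.Analysis" "HOL-Computational_Algebra.Formal_Laurent_Series"
begin

text \<open>
  The field \<open>F_q\<close> is a type \<open>'a :: {finite,field}\<close>, so \<open>q = CARD('a)\<close>. The field
  \<open>F_q((x^{-1}))\<close> is \<open>'a fls\<close> with the formal variable \<open>fls_X\<close> in the role of \<open>x^{-1}\<close>; hence
  \<open>x\<close> is \<open>fls_X_inv\<close>, and the embedding of \<open>F_q[x]\<close> is evaluation at \<open>fls_X_inv\<close>.
\<close>

definition poly_to_fls :: "'a::field poly \<Rightarrow> 'a fls" where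
  "poly_to_fls p = poly (map_poly fls_const p) fls_X_inv"

lemma poly_to_fls_0 [simp]: "poly_to_fls 0 = 0"
  by (simp add: poly_to_fls_def)

lemma poly_to_fls_pCons: "poly_to_fls (pCons a p) = fls_const a + fls_X_inv * poly_to_fls p"
  by (simp add: poly_to_fls_def map_poly_pCons)

lemma poly_to_fls_1 [simp]: "poly_to_fls 1 = 1"
  by (simp add: one_pCons poly_to_fls_pCons)

lemma poly_to_fls_add: "poly_to_fls (p + r) = poly_to_fls p + poly_to_fls r"
  by (induction p r rule: poly_induct2)
    (simp_all add: poly_to_fls_pCons fls_plus_const[symmetric] algebra_simps)

lemma poly_to_fls_smult: "poly_to_fls (smult a p) = fls_const a * poly_to_fls p"
  by (induction p) (simp_all add: poly_to_fls_pCons algebra_simps)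

lemma poly_to_fls_mult: "poly_to_fls (p * r) = poly_to_fls p * poly_to_fls r"
  by (induction p)
    (simp_all add: poly_to_fls_pCons poly_to_fls_add poly_to_fls_smult algebra_simps)

lemma poly_to_fls_nth:
  "fls_nth (poly_to_fls p) k = (if k \<le> 0 then coeff p (nat (- k)) else 0)"
proof (induction p arbitrary: k)
  case (pCons a p)
  have "nat (- k) = Suc (nat (- (k + 1)))" if "k < 0"
    using that by simp
  then show ?case
    by (cases "k < 0") (auto simp: poly_to_fls_pCons pCons.IH fls_X_inv_times_conv_shift)
qed simp

text \<open>A series of subdegree \<open>m\<close> has leading term \<open>x^{-m}\<close>, so its absolute value is \<open>q^{-m}\<close>.\<close>

definition fls_abs :: "'a::{finite,field} fls \<Rightarrow> real" where
  "fls_abs f = (if f = 0 then 0 else real CARD('a) powi (- fls_subdegree f))"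

lemma fls_abs_poly_to_fls:
  fixes p :: "'a::{finite,field} poly"
  assumes "p \<noteq> 0"
  shows "fls_abs (poly_to_fls p) = real CARD('a) ^ degree p"
proof -
  have lead: "fls_nth (poly_to_fls p) (- int (degree p)) \<noteq> 0"
    using assms by (simp add: poly_to_fls_nth)
  then have "poly_to_fls p \<noteq> 0"
    by auto
  moreover have "fls_subdegree (poly_to_fls p) = - int (degree p)"
    by (rule fls_subdegree_eqI[OF lead]) (auto simp: poly_to_fls_nth intro!: coeff_eq_0)
  ultimately show ?thesis
    by (simp add: fls_abs_def)
qed

definition vec_abs :: "('a::{finite,field} fls) ^ 'n \<Rightarrow> real" where
  "vec_abs v = Max (range (\<lambda>i. fls_abs (v $ i)))"

definition is_lattice :: "(('a::field fls) ^ 'n) set \<Rightarrow> bool" where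
  "is_lattice L \<longleftrightarrow>
     (\<exists>g :: 'a fls ^ 'n ^ 'n. invertible g \<and>
        L = range (\<lambda>w :: 'a poly ^ 'n. g *v (\<chi> i. poly_to_fls (w $ i))))"

definition poly_scale :: "'a::field poly \<Rightarrow> ('a fls) ^ 'n \<Rightarrow> ('a fls) ^ 'n" where
  "poly_scale p v = poly_to_fls p *s v"

interpretation poly_mod: module poly_scale
  by unfold_locales
    (simp_all add: poly_scale_def poly_to_fls_add poly_to_fls_mult vec.scale_right_distrib
      vec.scale_left_distrib)

text \<open>
  A family of \<open>d = CARD('n)\<close> vectors is indexed by \<open>'n\<close>. Independence in the library is a property
  of sets, so families additionally have to be injective.
\<close>

definition is_poly_basis :: "(('a::field fls) ^ 'n) set \<Rightarrow> ('n \<Rightarrow> ('a fls) ^ 'n) \<Rightarrow> bool" where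
  "is_poly_basis L v \<longleftrightarrow>
     inj v \<and> poly_mod.independent (range v) \<and> poly_mod.span (range v) = L"

definition orthogonal_family :: "('n \<Rightarrow> ('a::{finite,field} fls) ^ 'n) \<Rightarrow> bool" where
  "orthogonal_family v \<longleftrightarrow> fls_abs (det (\<chi> i j. v j $ i)) = (\<Prod>j\<in>UNIV. vec_abs (v j))"

text \<open>Here \<open>LEAST\<close> is the minimum; \<open>vec.independent\<close> is independence over \<open>'a fls\<close>.\<close>

definition successive_minimum :: "(('a::{finite,field} fls) ^ 'n) set \<Rightarrow> nat \<Rightarrow> real" where
  "successive_minimum L i =
     (LEAST r. r > 0 \<and>
        (\<exists>S \<subseteq> L. finite S \<and> card S = i \<and> vec.independent S \<and> (\<forall>v\<in>S. vec_abs v \<le> r)))"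

definition is_successive_minima_basis ::
    "(('a::{finite,field} fls) ^ 'n) set \<Rightarrow> (nat \<Rightarrow> ('a fls) ^ 'n) \<Rightarrow> bool" where
  "is_successive_minima_basis L w \<longleftrightarrow>
     w ` {1..CARD('n)} \<subseteq> L \<and>
     inj_on w {1..CARD('n)} \<and> vec.independent (w ` {1..CARD('n)}) \<and>
     (\<forall>i\<in>{1..CARD('n)}. vec_abs (w i) = successive_minimum L i)"

end

theory Submission
  imports Defs
begin

text \<open>
  Orthogonality controls coordinates: if \<open>w = \<Sum>j. c j *s v j\<close>, then \<open>\<bar>c k\<bar> * \<parallel>v k\<parallel> \<le> \<parallel>w\<parallel>\<close> for
  every \<open>k\<close> (\<open>orthogonal_family_coord_le\<close>). By Cramer's rule, \<open>c k * det V\<close> is the determinant of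
  the matrix \<open>V\<close> of the \<open>v j\<close> with column \<open>k\<close> replaced by \<open>w\<close>, and the ultrametric Hadamard
  inequality (\<open>fls_abs_det_le\<close>) bounds it by \<open>\<parallel>w\<parallel>\<close> times the product of the other \<open>\<parallel>v j\<parallel>\<close>, while
  orthogonality says that \<open>\<bar>det V\<bar>\<close> is the full product.

  When \<open>w\<close> lies in the lattice, the \<open>c j\<close> are polynomials, so a nonzero \<open>c k\<close> has absolute value at
  least \<open>1\<close>. A lattice vector shorter than \<open>v k\<close> therefore does not involve \<open>v k\<close>
  (\<open>short_vector_in_span\<close>). With the \<open>v j\<close> sorted by length, all lattice vectors strictly shorter
  than the \<open>i\<close>-th one lie in the span of the first \<open>i - 1\<close> over \<open>'a fls\<close>, which has no room for \<open>i\<close>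
  independent vectors. So \<open>\<parallel>v i\<parallel>\<close> is a lower bound for the \<open>i\<close>-th minimum, and \<open>v 1, \<dots>, v i\<close>
  show that it is attained.
\<close>

section \<open>The ultrametric absolute value\<close>

lemma fls_abs_0 [simp]: "fls_abs 0 = 0"
  by (simp add: fls_abs_def)

lemma fls_abs_nonneg [simp]: "0 \<le> fls_abs f"
  by (simp add: fls_abs_def)

lemma fls_abs_pos_iff [simp]: "0 < fls_abs f \<longleftrightarrow> f \<noteq> 0"
  by (auto simp: fls_abs_def)

lemma fls_abs_1 [simp]: "fls_abs 1 = 1"
  by (simp add: fls_abs_def)

lemma fls_abs_minus [simp]: "fls_abs (- f) = fls_abs f"
  by (simp add: fls_abs_def)

lemma fls_abs_mult: "fls_abs (f * g) = fls_abs f * fls_abs g"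
  by (auto simp: fls_abs_def power_int_add[symmetric])

lemma fls_abs_prod: "fls_abs (\<Prod>x\<in>A. f x) = (\<Prod>x\<in>A. fls_abs (f x))"
  by (induction A rule: infinite_finite_induct) (auto simp: fls_abs_mult)

lemma fls_abs_add_le: "fls_abs (f + g) \<le> max (fls_abs f) (fls_abs g)"
proof (cases "f = 0 \<or> g = 0 \<or> f + g = 0")
  case True
  then show ?thesis by (auto simp: le_max_iff_disj)
next
  case False
  have q: "1 \<le> real CARD('a)" by simp
  from False have "min (fls_subdegree f) (fls_subdegree g) \<le> fls_subdegree (f + g)"
    by (intro fls_plus_subdegree) auto
  then have "- fls_subdegree (f + g) \<le> - fls_subdegree f \<or>
    - fls_subdegree (f + g) \<le> - fls_subdegree g"
    by linarith
  with False show ?thesis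
    by (auto simp: fls_abs_def le_max_iff_disj intro: power_int_increasing[OF _ q])
qed

lemma fls_abs_sum_le:
  assumes "0 \<le> B" "\<And>x. x \<in> A \<Longrightarrow> fls_abs (f x) \<le> B"
  shows "fls_abs (\<Sum>x\<in>A. f x) \<le> B"
  using assms(2)
proof (induction A rule: infinite_finite_induct)
  case (insert x A)
  then show ?case
    using fls_abs_add_le[of "f x" "sum f A"] by force
qed (use assms(1) in auto)

lemma fls_abs_of_int_sign [simp]: "fls_abs (of_int (sign p)) = 1"
  by (simp add: sign_def)

lemma fls_abs_poly_ge_1:
  "p \<noteq> 0 \<Longrightarrow> 1 \<le> fls_abs (poly_to_fls p)"
  by (simp add: fls_abs_poly_to_fls)

lemma fls_abs_nth_le_vec_abs: "fls_abs (v $ i) \<le> vec_abs v"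
  by (auto simp: vec_abs_def)

lemma vec_abs_nonneg: "0 \<le> vec_abs v"
  using fls_abs_nonneg fls_abs_nth_le_vec_abs by (rule order_trans)

lemma vec_abs_pos:
  assumes "v \<noteq> 0"
  shows "0 < vec_abs v"
proof -
  obtain i where "v $ i \<noteq> 0" using assms by (auto simp: vec_eq_iff)
  then have "0 < fls_abs (v $ i)" by simp
  then show ?thesis using fls_abs_nth_le_vec_abs[of v i] by linarith
qed

section \<open>Orthogonal families\<close>

text \<open>
  Hadamard's inequality. In the Leibniz expansion every term takes exactly one entry from each
  column, so each term obeys the bound, and the ultrametric inequality passes it on to the sum.
\<close>

lemma fls_abs_det_le:
  fixes w :: "'n \<Rightarrow> ('a::{finite,field} fls) ^ 'n"
  shows "fls_abs (det (\<chi> i j. w j $ i)) \<le> (\<Prod>j\<in>UNIV. vec_abs (w j))"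
proof -
  have "fls_abs (\<Prod>j\<in>UNIV. w j $ p j) \<le> (\<Prod>j\<in>UNIV. vec_abs (w j))" for p :: "'n \<Rightarrow> 'n"
    unfolding fls_abs_prod by (intro prod_mono) (auto intro: fls_abs_nth_le_vec_abs)
  then have "fls_abs (det (transpose (\<chi> i j. w j $ i))) \<le> (\<Prod>j\<in>UNIV. vec_abs (w j))"
    unfolding det_def
    by (intro fls_abs_sum_le) (auto simp: fls_abs_mult transpose_def intro!: prod_nonneg vec_abs_nonneg)
  then show ?thesis by (simp add: det_transpose)
qed

lemma orthogonal_family_det_nonzero:
  assumes "orthogonal_family v" "\<And>j. v j \<noteq> 0"
  shows "det (\<chi> i j. v j $ i) \<noteq> 0"
proof -
  have "0 < (\<Prod>j\<in>UNIV. vec_abs (v j))"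
    using assms(2) by (intro prod_pos) (auto intro: vec_abs_pos)
  then show ?thesis
    using assms(1) unfolding orthogonal_family_def by (simp flip: fls_abs_pos_iff)
qed

lemma orthogonal_family_independent:
  assumes "orthogonal_family v" "\<And>j. v j \<noteq> 0"
  shows "vec.independent (range v)"
proof -
  have "columns (\<chi> i j. v j $ i) = range v"
    by (auto simp: columns_def column_def)
  then show ?thesis
    using orthogonal_family_det_nonzero[OF assms]
      det_dependent_rows[of "transpose (\<chi> i j. v j $ i)"]
    by (auto simp: det_transpose)
qed

text \<open>
  There is no cancellation between the terms of \<open>\<Sum>j. c j *s v j\<close>. Cramer's rule expresses
  \<open>c k\<close> as a quotient of determinants; the numerator obeys Hadamard's inequality, and orthogonality
  is equality in Hadamard's inequality for the denominator.
\<close>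

lemma orthogonal_family_coord_le:
  fixes v :: "'n \<Rightarrow> ('a::{finite,field} fls) ^ 'n"
  assumes orth: "orthogonal_family v" and nz: "\<And>j. v j \<noteq> 0"
  shows "fls_abs (c k) * vec_abs (v k) \<le> vec_abs (\<Sum>j\<in>UNIV. c j *s v j)"
proof -
  define w where "w = (\<Sum>j\<in>UNIV. c j *s v j)"
  define V :: "'a fls ^ 'n ^ 'n" where "V = (\<chi> i j. v j $ i)"
  define P where "P = (\<Prod>j\<in>UNIV - {k}. vec_abs (v j))"
  have "0 < P"
    unfolding P_def using nz by (intro prod_pos) (auto intro: vec_abs_pos)
  have split: "(\<Prod>j\<in>UNIV. vec_abs (u j)) = vec_abs (u k) * (\<Prod>j\<in>UNIV - {k}. vec_abs (u j))"
    for u :: "'n \<Rightarrow> 'a fls ^ 'n"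
    by (rule prod.remove) auto
  have w: "V *v (\<chi> j. c j) = w"
    by (simp add: V_def w_def vec_eq_iff matrix_vector_mult_def mult.commute)
  have "c k * det V = det (\<chi> i j. if j = k then (V *v (\<chi> j. c j)) $ i else V $ i $ j)"
    by (simp add: cramer_lemma)
  also have "(\<chi> i j. if j = k then (V *v (\<chi> j. c j)) $ i else V $ i $ j)
      = (\<chi> i j. (v(k := w)) j $ i)"
    unfolding w by (simp add: V_def vec_eq_iff)
  finally have "fls_abs (c k) * fls_abs (det V) = fls_abs (det (\<chi> i j. (v(k := w)) j $ i))"
    by (simp add: fls_abs_mult[symmetric])
  also have "\<dots> \<le> (\<Prod>j\<in>UNIV. vec_abs ((v(k := w)) j))"
    by (rule fls_abs_det_le)
  also have "\<dots> = vec_abs w * P"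
    unfolding split P_def by simp
  also have "fls_abs (det V) = vec_abs (v k) * P"
    using orth split[of v] by (simp add: orthogonal_family_def V_def P_def)
  finally show ?thesis
    using \<open>0 < P\<close> by (simp add: w_def mult.assoc[symmetric])
qed

section \<open>Short lattice vectors\<close>

lemma poly_span_range:
  fixes v :: "'n::finite \<Rightarrow> ('a::field fls) ^ 'n"
  assumes "inj v" "w \<in> poly_mod.span (range v)"
  obtains p where "w = (\<Sum>j\<in>UNIV. poly_to_fls (p j) *s v j)"
proof -
  obtain u where "w = (\<Sum>x\<in>range v. poly_scale (u x) x)"
    using assms(2) by (auto simp: poly_mod.span_finite)
  also have "\<dots> = (\<Sum>j\<in>UNIV. poly_to_fls (u (v j)) *s v j)"
    using assms(1) by (simp add: sum.reindex poly_scale_def)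
  finally show thesis by (rule that)
qed

text \<open>Nonzero polynomials have absolute value at least \<open>1\<close>, so a basis vector that enters \<open>w\<close>
  with a nonzero coefficient is no longer than \<open>w\<close>.\<close>

lemma short_vector_in_span:
  assumes basis: "is_poly_basis L v" and orth: "orthogonal_family v" and nz: "\<And>j. v j \<noteq> 0"
    and "w \<in> L"
  shows "w \<in> vec.span (v ` {j. vec_abs (v j) \<le> vec_abs w})"
proof -
  have "inj v" and "w \<in> poly_mod.span (range v)"
    using basis \<open>w \<in> L\<close> by (auto simp: is_poly_basis_def)
  then obtain p where w: "w = (\<Sum>j\<in>UNIV. poly_to_fls (p j) *s v j)"
    by (rule poly_span_range)
  have "vec_abs (v j) \<le> vec_abs w" if "p j \<noteq> 0" for j
  proof -
    have "1 * vec_abs (v j) \<le> fls_abs (poly_to_fls (p j)) * vec_abs (v j)"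
      using that by (intro mult_right_mono fls_abs_poly_ge_1 vec_abs_nonneg)
    also have "\<dots> \<le> vec_abs w"
      unfolding w by (rule orthogonal_family_coord_le[OF orth nz])
    finally show ?thesis by simp
  qed
  then have "poly_to_fls (p j) *s v j \<in> vec.span (v ` {j. vec_abs (v j) \<le> vec_abs w})" for j
    by (cases "p j = 0") (auto intro: vec.span_zero vec.span_scale vec.span_base)
  then have "(\<Sum>j\<in>UNIV. poly_to_fls (p j) *s v j) \<in> vec.span (v ` {j. vec_abs (v j) \<le> vec_abs w})"
    by (intro vec.span_sum)
  then show ?thesis using w by simp
qed

section \<open>Successive minima\<close>

theorem theorem1p21:
  fixes L :: "(('a::{finite,field} fls) ^ 'n) set"
    and v :: "'n \<Rightarrow> ('a fls) ^ 'n"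
    and \<sigma> :: "nat \<Rightarrow> 'n"
  assumes "CARD('n) \<ge> 2"
    and "is_lattice L"
    and "is_poly_basis L v"
    and "orthogonal_family v"
    and "bij_betw \<sigma> {1..CARD('n)} UNIV"
    and "\<And>i j. 1 \<le> i \<Longrightarrow> i \<le> j \<Longrightarrow> j \<le> CARD('n) \<Longrightarrow>
           vec_abs (v (\<sigma> i)) \<le> vec_abs (v (\<sigma> j))"
  shows "is_successive_minima_basis L (\<lambda>i. v (\<sigma> i))"
proof -
  note basis = assms(3) and orth = assms(4) and bij = assms(5) and sorted = assms(6)
  let ?w = "\<lambda>i. v (\<sigma> i)"
  have "inj v" and poly_indep: "poly_mod.independent (range v)" and L: "L = poly_mod.span (range v)"
    using basis by (auto simp: is_poly_basis_def)
  have nz: "v j \<noteq> 0" for j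
    using poly_indep poly_mod.dependent_zero by (metis rangeI)
  have indep: "vec.independent (range v)"
    using orth nz by (rule orthogonal_family_independent)
  have indep_sub: "vec.independent (?w ` A)" for A
    using indep by (rule vec.independent_mono) auto
  have in_L: "v j \<in> L" for j
    unfolding L by (rule poly_mod.span_base) simp
  have inj: "inj_on ?w {1..CARD('n)}"
    using comp_inj_on[OF bij_betw_imp_inj_on[OF bij] inj_on_subset[OF \<open>inj v\<close> subset_UNIV]]
    by (simp add: comp_def)
  have "vec_abs (?w i) = successive_minimum L i" if i: "i \<in> {1..CARD('n)}" for i
    unfolding successive_minimum_def
  proof (rule Least_equality[symmetric])
    have "card (?w ` {1..i}) = i"
      using i by (subst card_image) (auto intro: inj_on_subset[OF inj])
    moreover have "vec_abs u \<le> vec_abs (?w i)" if "u \<in> ?w ` {1..i}" for u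
      using that i sorted by auto
    ultimately show "vec_abs (?w i) > 0 \<and> (\<exists>S\<subseteq>L. finite S \<and> card S = i \<and> vec.independent S \<and>
        (\<forall>u\<in>S. vec_abs u \<le> vec_abs (?w i)))"
      using in_L indep_sub vec_abs_pos[OF nz]
      by (intro conjI exI[of _ "?w ` {1..i}"]) auto
  next
    fix r :: real
    assume "r > 0 \<and> (\<exists>S\<subseteq>L. finite S \<and> card S = i \<and> vec.independent S \<and> (\<forall>u\<in>S. vec_abs u \<le> r))"
    then obtain S where S: "S \<subseteq> L" "card S = i" "vec.independent S" "\<And>u. u \<in> S \<Longrightarrow> vec_abs u \<le> r"
      by blast
    show "vec_abs (?w i) \<le> r"
    proof (rule ccontr)
      assume less: "\<not> vec_abs (?w i) \<le> r"
      have short: "{j. vec_abs (v j) \<le> r} \<subseteq> \<sigma> ` {1..<i}"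
      proof
        fix j assume j: "j \<in> {j. vec_abs (v j) \<le> r}"
        obtain k where k: "k \<in> {1..CARD('n)}" "j = \<sigma> k"
          using bij_betw_imp_surj_on[OF bij] by blast
        have "\<not> i \<le> k"
          using sorted[of i k] i j k less by auto
        then show "j \<in> \<sigma> ` {1..<i}" using k by auto
      qed
      have "S \<subseteq> vec.span (?w ` {1..<i})"
      proof
        fix u assume u: "u \<in> S"
        have "{j. vec_abs (v j) \<le> vec_abs u} \<subseteq> \<sigma> ` {1..<i}"
          using S(4)[OF u] by (intro order_trans[OF _ short]) auto
        then have "v ` {j. vec_abs (v j) \<le> vec_abs u} \<subseteq> ?w ` {1..<i}"
          by (auto simp del: atLeastLessThan_iff)
        then show "u \<in> vec.span (?w ` {1..<i})"
          using short_vector_in_span[OF basis orth nz, of u] S(1) u vec.span_mono by blast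
      qed
      then have "card S \<le> card (?w ` {1..<i})"
        using vec.independent_span_bound[OF _ S(3)] by blast
      also have "\<dots> \<le> i - 1"
        using card_image_le[of "{1..<i}" ?w] by simp
      finally show False using S(2) i by auto
    qed
  qed
  then show ?thesis
    unfolding is_successive_minima_basis_def using inj in_L indep_sub by blast
qed

end
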